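(* Let $G=(V,E)$ be a finite connected graph (parallel edges allowed, no loops) with at least two vertices. Let $\kappa(G)$ denote the number of spanning trees of $G$ and $\kappa_2(G)$ the number of spanning forests of $G$ with exactly two connected components. Then \[ \frac{\kappa_2(G)}{\kappa(G)} \;\geq\; \frac{(|V|-1)^2}{4|E|}. \]
   Context: A spanning forest of $G$ is a subgraph containing all vertices of $G$ and no cycles; a two-forest is a spanning forest with exactly two connected components. *)

theory Defs
  imports Complex_Main
begin

record ('v, 'e) mgraph =
  verts :: "'v set"
  edges :: "'e set"
  ends  :: "'e \<Rightarrow> 'v set"

text \<open>Finite undirected multigraphs without loops: distinct edges may have the same
  two-element set of end points.\<close>

locale fin_loopless_mgraph =
  fixes G :: "('v, 'e) mgraph"
  assumes finite_verts: "finite (verts G)"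
    and finite_edges: "finite (edges G)"
    and ends_in_verts: "e \<in> edges G \<Longrightarrow> ends G e \<subseteq> verts G"
    and card_ends: "e \<in> edges G \<Longrightarrow> card (ends G e) = 2"

definition adj_rel :: "('v, 'e) mgraph \<Rightarrow> ('v \<times> 'v) set" where
  "adj_rel G = {(u, v). \<exists>e\<in>edges G. ends G e = {u, v}}"

definition conn_rel :: "('v, 'e) mgraph \<Rightarrow> ('v \<times> 'v) set" where
  "conn_rel G = {(u, v). u \<in> verts G \<and> v \<in> verts G \<and> (u, v) \<in> (adj_rel G)\<^sup>*}"

definition conn_components :: "('v, 'e) mgraph \<Rightarrow> 'v set set" where
  "conn_components G = verts G // conn_rel G"

definition connected_mgraph :: "('v, 'e) mgraph \<Rightarrow> bool" where
  "connected_mgraph G \<longleftrightarrow> verts G \<noteq> {} \<and> (\<forall>u\<in>verts G. \<forall>v\<in>verts G. (u, v) \<in> conn_rel G)"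

text \<open>A cycle is given by its cyclic sequences of vertices and of edges, where edge number
  \<open>i\<close> joins vertex number \<open>i\<close> to its cyclic successor. Distinctness of the edges matters for
  length two, where a cycle is a pair of distinct parallel edges.\<close>

definition is_cycle :: "('v, 'e) mgraph \<Rightarrow> 'v list \<Rightarrow> 'e list \<Rightarrow> bool" where
  "is_cycle G vs es \<longleftrightarrow>
     es \<noteq> [] \<and> length vs = length es \<and> distinct vs \<and> distinct es \<and>
     set vs \<subseteq> verts G \<and> set es \<subseteq> edges G \<and>
     (\<forall>i<length es. ends G (es ! i) = {vs ! i, vs ! (Suc i mod length vs)})"

definition acyclic_mgraph :: "('v, 'e) mgraph \<Rightarrow> bool" where
  "acyclic_mgraph G \<longleftrightarrow> (\<nexists>vs es. is_cycle G vs es)"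

text \<open>A subgraph containing all vertices is determined by its edge set \<open>F\<close>, so spanning
  subgraphs are represented, and counted, by their edge sets.\<close>

definition spanning_forest :: "('v, 'e) mgraph \<Rightarrow> 'e set \<Rightarrow> bool" where
  "spanning_forest G F \<longleftrightarrow> F \<subseteq> edges G \<and> acyclic_mgraph (G\<lparr>edges := F\<rparr>)"

definition spanning_tree :: "('v, 'e) mgraph \<Rightarrow> 'e set \<Rightarrow> bool" where
  "spanning_tree G F \<longleftrightarrow> spanning_forest G F \<and> connected_mgraph (G\<lparr>edges := F\<rparr>)"

definition two_forest :: "('v, 'e) mgraph \<Rightarrow> 'e set \<Rightarrow> bool" where
  "two_forest G F \<longleftrightarrow> spanning_forest G F \<and> card (conn_components (G\<lparr>edges := F\<rparr>)) = 2"

definition kappa :: "('v, 'e) mgraph \<Rightarrow> nat" where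
  "kappa G = card {F. spanning_tree G F}"

definition kappa2 :: "('v, 'e) mgraph \<Rightarrow> nat" where
  "kappa2 G = card {F. two_forest G F}"

end

theory Submission
  imports Defs "HOL-Analysis.Convex"
begin

text \<open>
  Fix a vertex \<open>q\<close> and let \<open>h x\<close> be the effective resistance between \<open>x\<close> and \<open>q\<close>, that is, the
  number of two-forests separating \<open>x\<close> from \<open>q\<close> divided by \<open>\<kappa>\<close>; for an edge \<open>e = uv\<close> let \<open>b e\<close>
  be the number of two-forests separating both ends from \<open>q\<close>, divided by \<open>\<kappa>\<close>, and let
  \<open>r e = h u + h v - 2 b e\<close>, which is the fraction of spanning trees containing \<open>e\<close>.

  In a two-forest, the component avoiding \<open>q\<close> has one more vertex than edges. Counting these
  vertices and edges over all two-forests gives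
  \<open>\<kappa>\<^sub>2 / \<kappa> = (\<Sum>x. h x) - (\<Sum>e. h u * h v - (b e)\<^sup>2)\<close>, because the two-forests containing \<open>e\<close> in
  that component correspond to the three-forests rooted at \<open>u, v, q\<close>, which are counted by a
  \<open>2 \<times> 2\<close> minor of the Green function of the Laplacian grounded at \<open>q\<close>. The Laplace equation
  \<open>(\<Sum>e \<ni> x. h x - b e) = 1\<close> for \<open>x \<noteq> q\<close>, multiplied by \<open>h x\<close> and summed over \<open>x\<close>, turns this into
  \<open>\<kappa>\<^sub>2 / \<kappa> = (\<Sum>e. (r e)\<^sup>2 + 3 (h u - h v)\<^sup>2) / 4\<close>. Since \<open>(\<Sum>e. r e) = |V| - 1\<close>, the bound follows by
  the Cauchy-Schwarz inequality.
\<close>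

section \<open>Double counting\<close>

lemma sum_card_swap:
  assumes "finite A" "finite B"
  shows "(\<Sum>a\<in>A. card {b\<in>B. P a b}) = (\<Sum>b\<in>B. card {a\<in>A. P a b})"
  using sum.swap_restrict[OF assms, of "\<lambda>_ _. 1 :: nat" P] by simp

lemma card_diff_card:
  assumes "finite A"
  shows "real (card {x\<in>A. P x}) - real (card {x\<in>A. Q x}) =
    real (card {x\<in>A. P x \<and> \<not> Q x}) - real (card {x\<in>A. Q x \<and> \<not> P x})"
proof -
  have "card {x\<in>A. P x} = card {x\<in>A. P x \<and> Q x} + card {x\<in>A. P x \<and> \<not> Q x}" for P Q
    using assms by (subst card_Un_disjoint[symmetric]) (auto intro: arg_cong[where f = card])
  from this[of P Q] this[of Q P] show ?thesis by (simp add: conj_commute)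
qed

section \<open>Connectivity by edge sets, forests and their roots\<close>

definition (in fin_loopless_mgraph) conn :: "'e set \<Rightarrow> ('v \<times> 'v) set" where
  "conn F = {(u, v). \<exists>e\<in>F. ends G e = {u, v}}\<^sup>*"

text \<open>Acyclicity phrased as every edge being a bridge, which suits adding and deleting edges;
  \<open>forest_iff_acyclic\<close> reconciles it with cycles.\<close>

definition (in fin_loopless_mgraph) forest :: "'e set \<Rightarrow> bool" where
  "forest F \<longleftrightarrow> F \<subseteq> edges G \<and>
     (\<forall>e\<in>F. \<forall>u v. ends G e = {u, v} \<longrightarrow> (u, v) \<notin> conn (F - {e}))"

text \<open>For vertices \<open>x\<close> and \<open>q\<close>, the set \<open>{q}\<close> yields
  the spanning trees, and \<open>{x, q}\<close> with \<open>x\<close> different from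
  \<open>q\<close> the two-forests separating \<open>x\<close> from \<open>q\<close>.\<close>

definition (in fin_loopless_mgraph) rooted_forests :: "'v set \<Rightarrow> 'e set set" where
  "rooted_forests S = {F. forest F \<and> (\<forall>x\<in>verts G. \<exists>s\<in>S. (x, s) \<in> conn F) \<and>
     (\<forall>s\<in>S. \<forall>t\<in>S. (s, t) \<in> conn F \<longrightarrow> s = t)}"

text \<open>For an edge \<open>e\<close> of a forest \<open>F\<close>: \<open>e\<close> is the first
  edge on the path from \<open>y\<close> to \<open>x\<close>.\<close>

definition (in fin_loopless_mgraph) beyond :: "'e set \<Rightarrow> 'e \<Rightarrow> 'v \<Rightarrow> 'v \<Rightarrow> bool" where
  "beyond F e y x \<longleftrightarrow> (\<exists>w. ends G e = {y, w} \<and> (x, w) \<in> conn (F - {e}))"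

context fin_loopless_mgraph
begin

lemma conn_refl [simp, intro]: "(x, x) \<in> conn F"
  by (simp add: conn_def)

lemma conn_sym: "(x, y) \<in> conn F \<Longrightarrow> (y, x) \<in> conn F"
  unfolding conn_def
  by (rule symD[OF sym_rtrancl]) (auto simp: sym_def insert_commute)

lemma conn_trans: "(x, y) \<in> conn F \<Longrightarrow> (y, z) \<in> conn F \<Longrightarrow> (x, z) \<in> conn F"
  unfolding conn_def by (rule rtrancl_trans)

text \<open>Turns connectivity into equality of classes, so that chains of connections are settled
  by equational reasoning.\<close>

lemma conn_iff: "(x, y) \<in> conn F \<longleftrightarrow> conn F `` {x} = conn F `` {y}"
proof
  assume "(x, y) \<in> conn F"
  then have "(x, z) \<in> conn F \<longleftrightarrow> (y, z) \<in> conn F" for z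
    using conn_trans[of y x F z] conn_trans[of x y F z] conn_sym[of x y F] by iprover
  then show "conn F `` {x} = conn F `` {y}" by auto
next
  assume "conn F `` {x} = conn F `` {y}"
  moreover have "y \<in> conn F `` {y}" by simp
  ultimately have "y \<in> conn F `` {x}" by simp
  then show "(x, y) \<in> conn F" by simp
qed

lemma conn_edge: "e \<in> F \<Longrightarrow> ends G e = {x, y} \<Longrightarrow> (x, y) \<in> conn F"
  unfolding conn_def by blast

lemma conn_mono: "F \<subseteq> F' \<Longrightarrow> (x, y) \<in> conn F \<Longrightarrow> (x, y) \<in> conn F'"
  unfolding conn_def by (rule rtrancl_mono[THEN subsetD]) auto

lemma conn_converse_induct [consumes 1, case_names refl step]:
  assumes "(x, y) \<in> conn F" and "P y"
    and "\<And>x x' e. e \<in> F \<Longrightarrow> ends G e = {x, x'} \<Longrightarrow> (x', y) \<in> conn F \<Longrightarrow> P x' \<Longrightarrow> P x"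
  shows "P x"
  using assms(1) unfolding conn_def
proof (induction rule: converse_rtrancl_induct)
  case base
  show ?case by (rule assms(2))
next
  case (step x x')
  then show ?case using assms(3)[of _ x x'] by (auto simp: conn_def)
qed

text \<open>A walk can be shortened until it uses \<open>e\<close> at most once, in one of the two
  directions.\<close>

lemma conn_insertD:
  assumes "(x, y) \<in> conn (insert e F)" and "ends G e = {u, w}"
  shows "(x, y) \<in> conn F \<or> ((x, u) \<in> conn F \<and> (w, y) \<in> conn F) \<or>
    ((x, w) \<in> conn F \<and> (u, y) \<in> conn F)"
  using assms(1)
proof (induction rule: conn_converse_induct)
  case refl
  then show ?case by simp
next
  case (step x x' e')
  show ?case
  proof (cases "e' = e")
    case True
    then have "x = u \<and> x' = w \<or> x = w \<and> x' = u"
      using step.hyps assms(2) by (auto simp: doubleton_eq_iff)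
    then show ?thesis using step.IH by (auto simp: conn_iff)
  next
    case False
    then have "(x, x') \<in> conn F" using step.hyps conn_edge by blast
    then show ?thesis using step.IH by (auto simp: conn_iff)
  qed
qed

lemma conn_removeD:
  assumes "(x, y) \<in> conn F" and "e \<in> F" and "ends G e = {u, w}"
  shows "(x, y) \<in> conn (F - {e}) \<or>
    ((x, u) \<in> conn (F - {e}) \<and> (w, y) \<in> conn (F - {e})) \<or>
    ((x, w) \<in> conn (F - {e}) \<and> (u, y) \<in> conn (F - {e}))"
  using conn_insertD[of x y e "F - {e}" u w] assms by (simp add: insert_absorb)

lemma ends_cases:
  assumes "e \<in> edges G"
  obtains u v where "ends G e = {u, v}" "u \<noteq> v" "u \<in> verts G" "v \<in> verts G"
  using card_ends[OF assms] ends_in_verts[OF assms] by (auto simp: card_2_iff)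

lemma ends_other:
  assumes "e \<in> edges G" "y \<in> ends G e"
  obtains w where "ends G e = {y, w}" "y \<noteq> w" "y \<in> verts G" "w \<in> verts G"
  proof -
  obtain u v where "ends G e = {u, v}" "u \<noteq> v" "u \<in> verts G" "v \<in> verts G"
    using ends_cases[OF assms(1)] .
  then show thesis using that[of u] that[of v] assms(2) by (auto simp: insert_commute)
qed

lemma forestD:
  "forest F \<Longrightarrow> e \<in> F \<Longrightarrow> ends G e = {u, v} \<Longrightarrow> (u, v) \<notin> conn (F - {e})"
  "forest F \<Longrightarrow> F \<subseteq> edges G"
  by (auto simp: forest_def)

lemma forest_subset: "forest F \<Longrightarrow> F' \<subseteq> F \<Longrightarrow> forest F'"
  unfolding forest_def using conn_mono[OF Diff_mono[OF _ order_refl, of F' F]]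
  by (simp add: subset_iff) metis

text \<open>If an old edge \<open>f\<close> stopped being a bridge, the detour around it would use
  \<open>e\<close>; closed up by \<open>f\<close>, the rest of the detour would join the ends of
  \<open>e\<close> inside \<open>F\<close>.\<close>

lemma forest_insert:
  assumes "forest F" "e \<in> edges G" "ends G e = {u, w}" "(u, w) \<notin> conn F"
  shows "forest (insert e F)"
  unfolding forest_def
proof (intro conjI ballI allI impI)
  show "insert e F \<subseteq> edges G" using assms forestD(2) by blast
next
  fix f x y
  assume f: "f \<in> insert e F" "ends G f = {x, y}"
  show "(x, y) \<notin> conn (insert e F - {f})"
  proof
    assume c: "(x, y) \<in> conn (insert e F - {f})"
    show False
    proof (cases "f = e")
      case True
      have "(x, y) \<in> conn F" using c True conn_mono[of "insert e F - {f}" F] by blast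
      moreover have "x = u \<and> y = w \<or> x = w \<and> y = u"
        using f True assms(3) by (auto simp: doubleton_eq_iff)
      ultimately show False using assms(4) conn_sym by blast
    next
      case False
      then have fF: "f \<in> F" using f by blast
      have "insert e F - {f} = insert e (F - {f})" using False by blast
      with c have "(x, y) \<in> conn (insert e (F - {f}))" by simp
      from conn_insertD[OF this assms(3)] forestD(1)[OF assms(1) fF f(2)]
      have "((x, u) \<in> conn (F - {f}) \<and> (w, y) \<in> conn (F - {f})) \<or>
        ((x, w) \<in> conn (F - {f}) \<and> (u, y) \<in> conn (F - {f}))" by blast
      then have "((x, u) \<in> conn F \<and> (w, y) \<in> conn F) \<or> ((x, w) \<in> conn F \<and> (u, y) \<in> conn F)"
        using conn_mono[of "F - {f}" F] by blast
      moreover have "(x, y) \<in> conn F" using conn_edge[OF fF f(2)] .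
      ultimately have "(u, w) \<in> conn F" by (auto simp: conn_iff)
      then show False using assms(4) by blast
    qed
  qed
qed

section \<open>Paths in a forest and their first edges\<close>

lemma ex_beyond:
  assumes "(x, y) \<in> conn F" and "x \<noteq> y"
  shows "\<exists>e\<in>F. beyond F e y x"
proof -
  have "x = y \<or> (\<exists>e\<in>F. beyond F e y x)"
    using assms(1)
  proof (induction rule: conn_converse_induct)
    case refl
    then show ?case by simp
  next
    case (step x x' e)
    show ?case
    proof (cases "x' = y")
      case True
      then show ?thesis using step.hyps unfolding beyond_def by (metis conn_refl insert_commute)
    next
      case False
      then obtain f w where f: "f \<in> F" "ends G f = {y, w}" "(x', w) \<in> conn (F - {f})"
        using step.IH unfolding beyond_def by blast
      show ?thesis
      proof (cases "e = f")
        case True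
        \<comment> \<open>The edge \<open>e\<close> has \<open>y\<close> as an end and
          \<open>x'\<close> is not \<open>y\<close>, so the walk starts at \<open>y\<close>
          itself.\<close>
        then have "x = y" using False f step.hyps by (auto simp: doubleton_eq_iff)
        then show ?thesis by simp
      next
        case neq: False
        then have "(x, x') \<in> conn (F - {f})" using step.hyps conn_edge[of e "F - {f}"] by blast
        then have "(x, w) \<in> conn (F - {f})" using f conn_trans by blast
        then show ?thesis using f unfolding beyond_def by blast
      qed
    qed
  qed
  then show ?thesis using assms(2) by blast
qed

text \<open>Let \<open>e = yw\<close> and \<open>f = yz\<close>. A connection from \<open>x\<close>
  to \<open>w\<close> avoiding \<open>e\<close> cannot cross \<open>f\<close>, since that would join
  \<open>y\<close> to \<open>w\<close> without \<open>e\<close>. Then \<open>y\<close>,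
  \<open>w\<close>, \<open>x\<close>, \<open>z\<close> is a detour around \<open>f\<close>.\<close>

lemma beyond_unique:
  assumes F: "forest F" and e: "e \<in> F" "beyond F e y x" and f: "f \<in> F" "beyond F f y x"
  shows "e = f"
proof (rule ccontr)
  assume neq: "e \<noteq> f"
  obtain w where w: "ends G e = {y, w}" "(x, w) \<in> conn (F - {e})"
    using e(2) unfolding beyond_def by blast
  obtain z where z: "ends G f = {y, z}" "(x, z) \<in> conn (F - {f})"
    using f(2) unfolding beyond_def by blast
  let ?K = "conn (F - {e} - {f})"
  have sub: "a \<in> ?K \<Longrightarrow> a \<in> conn (F - {e})" "a \<in> ?K \<Longrightarrow> a \<in> conn (F - {f})" for a
    using conn_mono[of "F - {e} - {f}" "F - {e}" "fst a" "snd a"]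
      conn_mono[of "F - {e} - {f}" "F - {f}" "fst a" "snd a"] by auto
  have fe: "(y, z) \<in> conn (F - {e})" using conn_edge[of f "F - {e}"] f z neq by blast
  have ef: "(y, w) \<in> conn (F - {f})" using conn_edge[of e "F - {f}"] e w neq by blast
  have "(x, w) \<in> ?K \<or> ((x, y) \<in> ?K \<and> (z, w) \<in> ?K) \<or> ((x, z) \<in> ?K \<and> (y, w) \<in> ?K)"
    using conn_removeD[OF w(2) _ z(1)] f(1) neq by blast
  moreover have "(y, w) \<notin> conn (F - {e})" using forestD(1)[OF F e(1) w(1)] .
  ultimately have "(x, w) \<in> ?K" using sub(1) fe by (metis conn_trans)
  then have "(x, w) \<in> conn (F - {f})" using sub(2) by blast
  then have "(y, z) \<in> conn (F - {f})" using ef z(2) by (simp add: conn_iff)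
  then show False using forestD(1)[OF F f(1) z(1)] by blast
qed

lemma not_beyond_self: "forest F \<Longrightarrow> e \<in> F \<Longrightarrow> \<not> beyond F e y y"
  using forestD(1)[of F e y] by (auto simp: beyond_def)

lemma card_beyond:
  assumes "forest F" and "(x, y) \<in> conn F"
  shows "card {e\<in>F. beyond F e y x} = (if x = y then 0 else 1)"
proof (cases "x = y")
  case True
  then have "{e\<in>F. beyond F e y x} = {}" using not_beyond_self assms(1) by blast
  then show ?thesis using True by (metis card.empty)
next
  case False
  then obtain e where "e \<in> F" "beyond F e y x" using ex_beyond assms by blast
  then have "{e\<in>F. beyond F e y x} = {e}" using beyond_unique[OF assms(1)] by blast
  then show ?thesis using False by simp
qed

lemma finite_forest: "forest F \<Longrightarrow> finite F"
  using forestD(2) finite_edges finite_subset by blast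

text \<open>Root the component at \<open>v\<close> and count the pairs of a vertex \<open>x\<close>
  and the first edge from \<open>x\<close> towards \<open>v\<close>: every vertex except
  \<open>v\<close> has one such edge, and every edge of the component belongs to one vertex.\<close>

lemma forest_card_component_edges:
  assumes F: "forest F" and v: "v \<in> verts G"
  defines "C \<equiv> {x \<in> verts G. (x, v) \<in> conn F}"
  shows "card C = card {e\<in>F. ends G e \<subseteq> C} + 1"
proof -
  have finC: "finite C" using finite_verts by (simp add: C_def)
  have finF: "finite F" using finite_forest[OF F] .
  have vC: "v \<in> C" using v by (simp add: C_def)
  \<comment> \<open>Deleting an edge of the component cuts exactly one of its two ends off from
    \<open>v\<close>, and that end is the vertex paired with it.\<close>
  have "card {x\<in>C. beyond F e x v} = (if ends G e \<subseteq> C then 1 else 0)" if e: "e \<in> F" for e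
  proof -
    obtain u w where uw: "ends G e = {u, w}" "u \<noteq> w" "u \<in> verts G" "w \<in> verts G"
      using ends_cases[of e] e forestD(2)[OF F] by blast
    have uwc: "(u, w) \<in> conn F" using conn_edge e uw by blast
    have nc: "(u, w) \<notin> conn (F - {e})" using forestD(1)[OF F e] uw by blast
    have b: "beyond F e x v \<longleftrightarrow> x = u \<and> (v, w) \<in> conn (F - {e}) \<or> x = w \<and> (v, u) \<in> conn (F - {e})"
      for x using uw by (auto simp: beyond_def doubleton_eq_iff)
    have sub: "a \<in> conn (F - {e}) \<Longrightarrow> a \<in> conn F" for a
      using conn_mono[of "F - {e}" F "fst a" "snd a"] by auto
    show ?thesis
    proof (cases "(v, u) \<in> conn F")
      case True
      then have C: "u \<in> C" "w \<in> C" using uw uwc by (auto simp: C_def conn_iff)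
      have "(v, u) \<in> conn (F - {e}) \<or> (v, w) \<in> conn (F - {e})"
        using conn_removeD[OF True e uw(1)] conn_sym by blast
      moreover have "\<not> ((v, u) \<in> conn (F - {e}) \<and> (v, w) \<in> conn (F - {e}))"
        using nc by (auto simp: conn_iff)
      ultimately have "{x\<in>C. beyond F e x v} = {u} \<or> {x\<in>C. beyond F e x v} = {w}"
        using C b by auto
      then show ?thesis using C uw by auto
    next
      case False
      then have "u \<notin> C" "(v, w) \<notin> conn F" using uwc by (auto simp: C_def conn_iff)
      moreover from this have "{x\<in>C. beyond F e x v} = {}"
        using False b sub by blast
      ultimately show ?thesis using uw(1) by (metis card.empty insert_subset)
    qed
  qed
  then have "(\<Sum>e\<in>F. card {x\<in>C. beyond F e x v}) = (\<Sum>e\<in>F. if ends G e \<subseteq> C then 1 else 0)"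
    by (rule sum.cong[OF refl])
  also have "\<dots> = card {e\<in>F. ends G e \<subseteq> C}"
    using finF by (simp add: sum.If_cases Collect_conj_eq)
  finally have 1: "(\<Sum>e\<in>F. card {x\<in>C. beyond F e x v}) = card {e\<in>F. ends G e \<subseteq> C}" .
  have "(\<Sum>x\<in>C. card {e\<in>F. beyond F e x v}) = (\<Sum>x\<in>C. if v = x then 0 else 1)"
    using card_beyond[OF F] conn_sym by (intro sum.cong) (auto simp: C_def)
  also have "\<dots> = card (C - {v})"
    using finC by (subst sum.If_cases) (auto intro: arg_cong[where f = card])
  finally show ?thesis
    using 1 sum_card_swap[OF finC finF, of "\<lambda>x e. beyond F e x v"] vC finC
    by (simp add: card_Suc_Diff1 del: card_Diff_insert)
qed

section \<open>Forests and the absence of cycles\<close>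

lemma ex_simple_path:
  assumes "(u, v) \<in> conn F"
  shows "\<exists>vs. vs \<noteq> [] \<and> hd vs = u \<and> last vs = v \<and> distinct vs \<and>
    successively (\<lambda>x y. \<exists>e\<in>F. ends G e = {x, y}) vs"
  using assms
proof (induction rule: conn_converse_induct)
  case refl
  show ?case by (rule exI[of _ "[v]"]) simp
next
  case (step x x' e)
  then obtain vs where vs: "vs \<noteq> []" "hd vs = x'" "last vs = v" "distinct vs"
    "successively (\<lambda>x y. \<exists>e\<in>F. ends G e = {x, y}) vs" by blast
  show ?case
  proof (cases "x \<in> set vs")
    case True
    \<comment> \<open>If \<open>x\<close> already lies on the path, the tail starting at
      \<open>x\<close> is the simple path sought.\<close>
    then obtain as bs where "vs = as @ x # bs" using split_list by metis
    then show ?thesis using vs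
      by (intro exI[of _ "x # bs"]) (auto simp: successively_append_iff)
  next
    case False
    then show ?thesis using vs step.hyps
      by (intro exI[of _ "x # vs"]) (auto simp: successively_Cons)
  qed
qed

text \<open>The rest of a cycle is a detour around its last edge; conversely, an edge that is no
  bridge closes a simple path between its ends to a cycle.\<close>

lemma forest_iff_acyclic:
  assumes FE: "F \<subseteq> edges G"
  shows "forest F \<longleftrightarrow> acyclic_mgraph (G\<lparr>edges := F\<rparr>)"
proof
  assume F: "forest F"
  show "acyclic_mgraph (G\<lparr>edges := F\<rparr>)"
    unfolding acyclic_mgraph_def
  proof (intro notI, elim exE)
    fix vs es assume "is_cycle (G\<lparr>edges := F\<rparr>) vs es"
    then have c: "es \<noteq> []" "length vs = length es" "distinct es" "set es \<subseteq> F"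
      and ends: "\<And>i. i < length es \<Longrightarrow> ends G (es ! i) = {vs ! i, vs ! (Suc i mod length vs)}"
      by (auto simp: is_cycle_def)
    define n where "n = length es - 1"
    have len: "length es = Suc n" using c by (simp add: n_def)
    let ?e = "es ! n"
    have eF: "?e \<in> F" using c len by auto
    have "k \<le> n \<Longrightarrow> (vs ! 0, vs ! k) \<in> conn (F - {?e})" for k
    proof (induction k)
      case (Suc k)
      have "es ! k \<noteq> ?e" using Suc c len by (simp add: nth_eq_iff_index_eq)
      moreover have "es ! k \<in> F" using Suc c len by auto
      moreover have "ends G (es ! k) = {vs ! k, vs ! Suc k}"
        using ends[of k] Suc len c by simp
      ultimately have "(vs ! k, vs ! Suc k) \<in> conn (F - {?e})"
        by (intro conn_edge[of "es ! k"]) auto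
      then show ?case using Suc conn_trans by (meson Suc_leD)
    qed simp
    from this[of n] have "(vs ! n, vs ! 0) \<in> conn (F - {?e})" using conn_sym by blast
    moreover have "ends G ?e = {vs ! n, vs ! 0}" using ends[of n] len c by simp
    ultimately show False using forestD(1)[OF F eF] by blast
  qed
next
  assume ac: "acyclic_mgraph (G\<lparr>edges := F\<rparr>)"
  show "forest F"
    unfolding forest_def
  proof (intro conjI ballI allI impI FE notI)
    fix e u v
    assume e: "e \<in> F" "ends G e = {u, v}" and "(u, v) \<in> conn (F - {e})"
    then obtain vs where vs: "vs \<noteq> []" "hd vs = u" "last vs = v" "distinct vs"
      and succ: "successively (\<lambda>x y. \<exists>f\<in>F - {e}. ends G f = {x, y}) vs"
      using ex_simple_path by blast
    define n where "n = length vs - 1"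
    have len: "length vs = Suc n" using vs by (simp add: n_def)
    have "\<forall>i<n. \<exists>f. f \<in> F - {e} \<and> ends G f = {vs ! i, vs ! Suc i}"
      using succ len by (auto simp: successively_conv_nth)
    then obtain g where g: "\<And>i. i < n \<Longrightarrow> g i \<in> F - {e}"
        "\<And>i. i < n \<Longrightarrow> ends G (g i) = {vs ! i, vs ! Suc i}" by metis
    \<comment> \<open>The vertices are distinct, so the pair of vertices \<open>i\<close> and
      \<open>Suc i\<close> determines \<open>i\<close>.\<close>
    have inj: "inj_on g {..<n}"
    proof (rule inj_onI)
      fix i j assume ij: "i \<in> {..<n}" "j \<in> {..<n}" "g i = g j"
      then have "{vs ! i, vs ! Suc i} = {vs ! j, vs ! Suc j}" using g(2) by (metis lessThan_iff)
      then show "i = j" using ij vs(4) len by (auto simp: doubleton_eq_iff nth_eq_iff_index_eq)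
    qed
    \<comment> \<open>The edge \<open>e\<close> gets the last index \<open>n\<close>, where the
      successor wraps around from \<open>v\<close> to \<open>u\<close>.\<close>
    define es where "es = map g [0..<n] @ [e]"
    have "set vs \<subseteq> verts G"
    proof
      fix x assume "x \<in> set vs"
      then obtain i where i: "i < Suc n" "x = vs ! i" using len by (metis in_set_conv_nth)
      show "x \<in> verts G"
      proof (cases "i = n")
        case True
        then have "x = v" using i vs len by (simp add: last_conv_nth)
        then show ?thesis using e FE ends_in_verts by blast
      next
        case False
        then have "x \<in> ends G (g i)" "g i \<in> F" using g[of i] i by auto
        then show ?thesis using FE ends_in_verts by blast
      qed
    qed
    moreover have "distinct es" using inj g(1) by (auto simp: es_def distinct_map atLeast0LessThan)
    moreover have "set es \<subseteq> F" using g(1) e by (auto simp: es_def)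
    moreover have "ends G (es ! i) = {vs ! i, vs ! (Suc i mod length vs)}" if "i < length es" for i
    proof (cases "i = n")
      case True
      then have "es ! i = e" by (simp add: es_def nth_append)
      moreover have "vs ! n = v" "vs ! 0 = u" using vs len by (auto simp: last_conv_nth hd_conv_nth)
      ultimately show ?thesis using e True len by (simp add: insert_commute)
    next
      case False
      then have "i < n" using that by (simp add: es_def)
      then show ?thesis using g(2) len by (simp add: es_def nth_append)
    qed
    ultimately have "is_cycle (G\<lparr>edges := F\<rparr>) vs es"
      using vs len by (auto simp: is_cycle_def es_def)
    then show False using ac by (auto simp: acyclic_mgraph_def)
  qed
qed

end


section \<open>The Laplacian, its Green function and the exchange of one edge\<close>

text \<open>The summand for an edge \<open>e = yw\<close> is \<open>f y - f w\<close>; the sum over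
  both ends spares naming \<open>w\<close>.\<close>

definition (in fin_loopless_mgraph) laplace :: "('v \<Rightarrow> real) \<Rightarrow> 'v \<Rightarrow> real" where
  "laplace f y = (\<Sum>e | e \<in> edges G \<and> y \<in> ends G e. 2 * f y - sum f (ends G e))"

text \<open>Up to the factor \<open>card (rooted_forests S)\<close> this is the Green function of the Laplacian
  grounded at \<open>S\<close>.\<close>

definition (in fin_loopless_mgraph) green :: "'v set \<Rightarrow> 'v \<Rightarrow> 'v \<Rightarrow> real" where
  "green S v x = real (card {F \<in> rooted_forests (insert v S). (v, x) \<in> conn F})"

context fin_loopless_mgraph
begin

lemma finite_rooted_forests: "finite (rooted_forests S)"
proof (rule finite_subset)
  show "rooted_forests S \<subseteq> Pow (edges G)"
    using forestD(2) by (auto simp: rooted_forests_def)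
qed (use finite_edges in simp)

lemma rooted_forestsD:
  assumes "F \<in> rooted_forests S"
  shows "forest F" "x \<in> verts G \<Longrightarrow> \<exists>s\<in>S. (x, s) \<in> conn F"
    "s \<in> S \<Longrightarrow> t \<in> S \<Longrightarrow> (s, t) \<in> conn F \<Longrightarrow> s = t"
  using assms unfolding rooted_forests_def by (simp_all del: bex_simps ball_simps)

text \<open>The edge \<open>e\<close> merges the component of \<open>v\<close> with that of
  \<open>p'\<close>, which has its root in \<open>S\<close>; so \<open>v\<close> ceases to be a root
  and the other components stay as they are.\<close>

lemma insert_mem_rooted_forests:
  assumes v: "v \<notin> S" and e: "e \<in> edges G" "ends G e = {p, p'}"
    and F: "F \<in> rooted_forests (insert v S)" and c: "(v, p) \<in> conn F" "(v, p') \<notin> conn F"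
  shows "e \<notin> F" "insert e F \<in> rooted_forests S" "\<exists>s\<in>S. (s, p') \<in> conn F"
proof -
  note D = rooted_forestsD[OF F]
  have np: "(p, p') \<notin> conn F" using c by (auto simp: conn_iff)
  then show "e \<notin> F" using conn_edge e by blast
  have "p' \<in> verts G" using e ends_in_verts by blast
  then obtain s where s: "s \<in> S" "(s, p') \<in> conn F"
    using D(2)[of p'] c by (auto simp: conn_iff)
  then show "\<exists>s\<in>S. (s, p') \<in> conn F" by blast
  let ?T = "insert e F"
  have up: "(x, y) \<in> conn F \<Longrightarrow> (x, y) \<in> conn ?T" for x y using conn_mono[of F ?T] by blast
  have pT: "(p, p') \<in> conn ?T" using conn_edge[of e ?T] e by blast
  have vs: "(v, s) \<in> conn ?T"
    using up[OF c(1)] pT up[OF s(2)] by (simp add: conn_iff)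
  have sv: "(x, v) \<notin> conn F" if "x \<in> S" for x using D(3)[of x v] that v by auto
  show "?T \<in> rooted_forests S"
    unfolding rooted_forests_def
  proof (intro CollectI conjI ballI impI)
    show "forest ?T" using forest_insert[OF D(1) e np] .
  next
    fix x assume "x \<in> verts G"
    then obtain t where t: "t \<in> insert v S" "(x, t) \<in> conn F" using D(2) by blast
    show "\<exists>s\<in>S. (x, s) \<in> conn ?T"
    proof (cases "t = v")
      case True
      then have "(x, s) \<in> conn ?T" using up[OF t(2)] vs conn_trans by blast
      then show ?thesis using s by blast
    next
      case False
      then show ?thesis using up[OF t(2)] t(1) by blast
    qed
  next
    fix x y assume xy: "x \<in> S" "y \<in> S" "(x, y) \<in> conn ?T"
    \<comment> \<open>A connection through \<open>e\<close> would reach \<open>p\<close>, hence the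
      component of \<open>v\<close>, which contains no element of \<open>S\<close>.\<close>
    have "(x, p) \<notin> conn F" "(p, y) \<notin> conn F"
      using sv[OF xy(1)] sv[OF xy(2)] c by (auto simp: conn_iff)
    then have "(x, y) \<in> conn F" using conn_insertD[OF xy(3) e(2)] by blast
    then show "x = y" using D(3) xy by blast
  qed
qed

text \<open>Deleting \<open>e\<close> splits one tree: the part of \<open>p'\<close> keeps the root
  \<open>s\<close>, and the part of \<open>p\<close> gets the new root \<open>v\<close>.\<close>

lemma remove_mem_rooted_forests:
  assumes e: "e \<in> T" "ends G e = {p, p'}" and T: "T \<in> rooted_forests S"
    and c: "(v, p) \<in> conn (T - {e})" "s \<in> S" "(s, p') \<in> conn (T - {e})"
  shows "T - {e} \<in> rooted_forests (insert v S)" "(v, p') \<notin> conn (T - {e})"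
proof -
  note D = rooted_forestsD[OF T]
  let ?F = "T - {e}"
  have np: "(p, p') \<notin> conn ?F" using forestD(1)[OF D(1) e] .
  then show "(v, p') \<notin> conn ?F" using c by (auto simp: conn_iff)
  have up: "(x, y) \<in> conn ?F \<Longrightarrow> (x, y) \<in> conn T" for x y using conn_mono[of ?F T] by blast
  have pT: "(p, p') \<in> conn T" using conn_edge[of e T] e by blast
  \<comment> \<open>Such an \<open>x\<close> would be joined to \<open>s\<close> through
    \<open>e\<close>, hence equal \<open>s\<close>, and then \<open>e\<close> would be no bridge of
    \<open>T\<close>.\<close>
  have sv: "(x, v) \<notin> conn ?F" if "x \<in> S" for x
  proof
    assume x: "(x, v) \<in> conn ?F"
    have "(x, s) \<in> conn T" using up[OF x] up[OF c(1)] pT up[OF c(3)] by (simp add: conn_iff)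
    then have "x = s" using D(3) that c by blast
    then show False using x np c by (simp add: conn_iff)
  qed
  show "?F \<in> rooted_forests (insert v S)"
    unfolding rooted_forests_def
  proof (intro CollectI conjI ballI impI)
    show "forest ?F" using forest_subset[OF D(1)] by blast
  next
    fix x assume "x \<in> verts G"
    then obtain t where t: "t \<in> S" "(x, t) \<in> conn T" using D(2) by blast
    from conn_removeD[OF t(2) e]
    have "(x, t) \<in> conn ?F \<or> (x, v) \<in> conn ?F \<or> (x, s) \<in> conn ?F"
      using c by (auto simp: conn_iff)
    then show "\<exists>s\<in>insert v S. (x, s) \<in> conn ?F" using t c by blast
  next
    fix x y assume xy: "x \<in> insert v S" "y \<in> insert v S" "(x, y) \<in> conn ?F"
    show "x = y"
    proof (cases "x = v \<or> y = v")
      case True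
      then show ?thesis using xy sv conn_sym[OF xy(3)] by blast
    next
      case False
      then show ?thesis using xy D(3) up by blast
    qed
  qed
qed

text \<open>Adding \<open>e\<close> is a bijection, with deletion as its inverse. The right-hand
  side counts the forests in which the path from \<open>v\<close> to its root crosses
  \<open>e\<close> from \<open>p\<close> to \<open>p'\<close>.\<close>

lemma card_rooted_forests_insert:
  assumes "v \<notin> S" and e: "e \<in> edges G" "ends G e = {p, p'}"
  shows "card {F \<in> rooted_forests (insert v S). (v, p) \<in> conn F \<and> (v, p') \<notin> conn F} =
    card {T \<in> rooted_forests S. e \<in> T \<and> (v, p) \<in> conn (T - {e}) \<and> (\<exists>s\<in>S. (s, p') \<in> conn (T - {e}))}"
    (is "card ?A = card ?B")
proof (rule bij_betw_same_card[of "insert e"])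
  note I = insert_mem_rooted_forests[OF assms]
  have "e \<notin> F \<and> insert e F \<in> ?B" if "F \<in> ?A" for F
    using I[of F] that by simp
  moreover have "T - {e} \<in> ?A" if "T \<in> ?B" for T
    using remove_mem_rooted_forests[of e T p p' S v] that e(2) by blast
  ultimately show "bij_betw (insert e) ?A ?B"
    by (intro bij_betw_byWitness[where f' = "\<lambda>T. T - {e}"] ballI image_subsetI)
      (blast | metis (no_types, lifting) Diff_insert_absorb)+
qed

lemma conn_or_beyond:
  assumes "(x, y) \<in> conn F" "e \<in> F" "e \<in> edges G" "y \<in> ends G e"
  shows "(x, y) \<in> conn (F - {e}) \<or> beyond F e y x"
proof -
  obtain w where w: "ends G e = {y, w}" using ends_other assms by metis
  from conn_removeD[OF assms(1,2) w] show ?thesis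
    using w unfolding beyond_def by blast
qed

lemma beyond_not_conn:
  assumes "forest F" "e \<in> F" "beyond F e y x"
  shows "(x, y) \<notin> conn (F - {e})" "(x, y) \<in> conn F"
proof -
  obtain w where w: "ends G e = {y, w}" "(x, w) \<in> conn (F - {e})"
    using assms unfolding beyond_def by blast
  show "(x, y) \<notin> conn (F - {e})" using forestD(1)[OF assms(1,2) w(1)] w(2) by (auto simp: conn_iff)
  have "(x, w) \<in> conn F" using conn_mono[OF _ w(2), of F] by blast
  moreover have "(y, w) \<in> conn F" using conn_edge[OF assms(2) w(1)] .
  ultimately show "(x, y) \<in> conn F" by (simp add: conn_iff)
qed

text \<open>The path from \<open>v\<close> to its root leaves \<open>y\<close> as often as it enters \<open>y\<close>, except that it
  leaves \<open>v\<close> once more. The edges along which it leaves (enters) are those beyond which only the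
  root (only \<open>v\<close>) lies.\<close>

lemma rooted_forest_flow:
  assumes T: "T \<in> rooted_forests S" and v: "v \<in> verts G" and y: "y \<notin> S"
  shows "real (card {e\<in>T. y \<in> ends G e \<and> (v, y) \<in> conn (T - {e}) \<and> (\<exists>s\<in>S. beyond T e y s)}) -
    real (card {e\<in>T. y \<in> ends G e \<and> beyond T e y v \<and> (\<exists>s\<in>S. (s, y) \<in> conn (T - {e}))}) =
    (if y = v then 1 else 0)" (is "real (card ?Out) - real (card ?In) = _")
proof -
  note D = rooted_forestsD[OF T]
  note B = beyond_not_conn[OF D(1)]
  have up: "(x, z) \<in> conn (T - {e}) \<Longrightarrow> (x, z) \<in> conn T" for x z e
    using conn_mono[of "T - {e}" T] by blast
  show ?thesis
  proof (cases "(v, y) \<in> conn T")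
    case False
    then have "?Out = {}" "?In = {}" using up B(2) by auto
    moreover have "y \<noteq> v" using False by auto
    ultimately show ?thesis by (simp only: card.empty) simp
  next
    case True
    obtain s where s: "s \<in> S" "(v, s) \<in> conn T" using D(2)[OF v] by blast
    have sy: "(s, y) \<in> conn T" using s(2) True by (simp add: conn_iff)
    have root: "t = s" if "t \<in> S" "(t, y) \<in> conn T" for t
      using D(3)[OF that(1) s(1)] that(2) sy by (simp add: conn_iff)
    have E: "y \<in> ends G e" if "beyond T e y x" for e x using that by (auto simp: beyond_def)
    have TE: "e \<in> edges G" if "e \<in> T" for e using that forestD(2)[OF D(1)] by blast
    \<comment> \<open>Since \<open>v\<close> and \<open>s\<close> lie in the component of
      \<open>y\<close>, being joined to \<open>y\<close> without the edge \<open>e\<close> at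
      \<open>y\<close> is the negation of lying beyond \<open>e\<close>.\<close>
    have out: "y \<in> ends G e \<and> (v, y) \<in> conn (T - {e}) \<and> (\<exists>s\<in>S. beyond T e y s) \<longleftrightarrow>
        beyond T e y s \<and> \<not> beyond T e y v" if e: "e \<in> T" for e
      using root B[OF e] conn_or_beyond[OF True e TE[OF e]] E s(1) by metis
    have inn: "y \<in> ends G e \<and> beyond T e y v \<and> (\<exists>s\<in>S. (s, y) \<in> conn (T - {e})) \<longleftrightarrow>
        beyond T e y v \<and> \<not> beyond T e y s" if e: "e \<in> T" for e
      using root B[OF e] up conn_or_beyond[OF sy e TE[OF e]] E s(1) by metis
    have "?Out = {e\<in>T. beyond T e y s \<and> \<not> beyond T e y v}"
      by (rule Collect_cong, rule conj_cong[OF refl], rule out)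
    moreover have "?In = {e\<in>T. beyond T e y v \<and> \<not> beyond T e y s}"
      by (rule Collect_cong, rule conj_cong[OF refl], rule inn)
    moreover have "s \<noteq> y" using s y by auto
    \<comment> \<open>Exactly one edge at \<open>y\<close> leads towards \<open>s\<close>, and
      exactly one towards \<open>v\<close> unless \<open>v = y\<close>.\<close>
    ultimately show ?thesis
      using card_diff_card[OF finite_forest[OF D(1)], of "\<lambda>e. beyond T e y s" "\<lambda>e. beyond T e y v"]
        card_beyond[OF D(1) sy] card_beyond[OF D(1) True]
      by (simp only: eq_commute[of v y] if_False) (simp split: if_splits)
  qed
qed

text \<open>By the exchange, an edge at \<open>y\<close> contributes the number of forests rooted at
  \<open>S\<close> whose path from \<open>v\<close> to its root leaves \<open>y\<close> along it,
  minus the number of those entering \<open>y\<close> along it. Summing over the edges first leaves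
  the flow balance of each forest.\<close>

lemma laplace_green:
  assumes "v \<in> verts G" "v \<notin> S" "y \<notin> S"
  shows "laplace (green S v) y = (if y = v then real (card (rooted_forests S)) else 0)"
proof -
  let ?E = "{e \<in> edges G. y \<in> ends G e}" and ?R = "rooted_forests S"
  let ?out = "\<lambda>T e. e \<in> T \<and> (v, y) \<in> conn (T - {e}) \<and> (\<exists>s\<in>S. beyond T e y s)"
  let ?in = "\<lambda>T e. e \<in> T \<and> beyond T e y v \<and> (\<exists>s\<in>S. (s, y) \<in> conn (T - {e}))"
  have finE: "finite ?E" using finite_edges by simp
  have "2 * green S v y - sum (green S v) (ends G e) =
      real (card {T\<in>?R. ?out T e}) - real (card {T\<in>?R. ?in T e})" if e: "e \<in> ?E" for e
  proof -
    obtain w where w: "ends G e = {y, w}" "y \<noteq> w" using ends_other[of e y] e by blast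
    then have w': "ends G e = {w, y}" by blast
    have eE: "e \<in> edges G" using e by blast
    have bey: "beyond T e y x \<longleftrightarrow> (x, w) \<in> conn (T - {e})" for T x
      using w by (auto simp: beyond_def doubleton_eq_iff)
    have "2 * green S v y - sum (green S v) (ends G e) = green S v y - green S v w"
      using w by simp
    also have "\<dots> =
        real (card {F \<in> rooted_forests (insert v S). (v, y) \<in> conn F \<and> (v, w) \<notin> conn F}) -
        real (card {F \<in> rooted_forests (insert v S). (v, w) \<in> conn F \<and> (v, y) \<notin> conn F})"
      unfolding green_def by (rule card_diff_card[OF finite_rooted_forests])
    also have "\<dots> = real (card {T\<in>?R. ?out T e}) - real (card {T\<in>?R. ?in T e})"
      unfolding bey card_rooted_forests_insert[OF assms(2) eE w(1)]
        card_rooted_forests_insert[OF assms(2) eE w'] ..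
    finally show ?thesis .
  qed
  then have "laplace (green S v) y =
      (\<Sum>e\<in>?E. real (card {T\<in>?R. ?out T e}) - real (card {T\<in>?R. ?in T e}))"
    unfolding laplace_def by (intro sum.cong) auto
  also have "\<dots> = real (\<Sum>e\<in>?E. card {T\<in>?R. ?out T e}) - real (\<Sum>e\<in>?E. card {T\<in>?R. ?in T e})"
    by (simp add: sum_subtractf)
  also have "\<dots> = real (\<Sum>T\<in>?R. card {e\<in>?E. ?out T e}) - real (\<Sum>T\<in>?R. card {e\<in>?E. ?in T e})"
    unfolding sum_card_swap[OF finE finite_rooted_forests] ..
  also have "\<dots> = (\<Sum>T\<in>?R. real (card {e\<in>?E. ?out T e}) - real (card {e\<in>?E. ?in T e}))"
    by (simp add: sum_subtractf)
  also have "\<dots> = (\<Sum>T\<in>?R. if y = v then 1 else 0)"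
  proof (rule sum.cong[OF refl])
    fix T assume T: "T \<in> ?R"
    then have TE: "T \<subseteq> edges G" using rooted_forestsD(1) forestD(2) by metis
    have "{e\<in>?E. ?out T e} =
        {e\<in>T. y \<in> ends G e \<and> (v, y) \<in> conn (T - {e}) \<and> (\<exists>s\<in>S. beyond T e y s)}"
      "{e\<in>?E. ?in T e} =
        {e\<in>T. y \<in> ends G e \<and> beyond T e y v \<and> (\<exists>s\<in>S. (s, y) \<in> conn (T - {e}))}"
      using TE by auto
    then show "real (card {e\<in>?E. ?out T e}) - real (card {e\<in>?E. ?in T e}) = (if y = v then 1 else 0)"
      using rooted_forest_flow[OF T assms(1,3)] by simp
  qed
  finally show ?thesis by simp
qed

lemma green_root: "v \<notin> S \<Longrightarrow> s \<in> S \<Longrightarrow> green S v s = 0"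
proof -
  assume "v \<notin> S" "s \<in> S"
  then have "{F \<in> rooted_forests (insert v S). (v, s) \<in> conn F} = {}"
    using rooted_forestsD(3)[of _ "insert v S" v s] by auto
  then show ?thesis unfolding green_def by (simp only: card.empty of_nat_0)
qed

lemma green_self: "green S v v = real (card (rooted_forests (insert v S)))"
  by (simp add: green_def)

lemma green_le: "green S v x \<le> green S v v"
  unfolding green_def using finite_rooted_forests by (auto intro!: card_mono)

section \<open>Symmetry of the Laplacian and a minor of the Green function\<close>

text \<open>Summation by parts: the summand for \<open>e = uv\<close> equals
  \<open>(g u - g v) * (f u - f v)\<close>.\<close>

lemma sum_mult_laplace:
  "(\<Sum>y\<in>verts G. g y * laplace f y) =
   (\<Sum>e\<in>edges G. 2 * (\<Sum>y\<in>ends G e. g y * f y) - sum g (ends G e) * sum f (ends G e))"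
proof -
  have "(\<Sum>y\<in>verts G. g y * laplace f y) =
      (\<Sum>y\<in>verts G. \<Sum>e | e \<in> edges G \<and> y \<in> ends G e. g y * (2 * f y - sum f (ends G e)))"
    by (simp add: laplace_def sum_distrib_left)
  also have "\<dots> = (\<Sum>e\<in>edges G. \<Sum>y | y \<in> verts G \<and> y \<in> ends G e. g y * (2 * f y - sum f (ends G e)))"
    by (rule sum.swap_restrict[OF finite_verts finite_edges])
  also have "\<dots> = (\<Sum>e\<in>edges G. \<Sum>y\<in>ends G e. g y * (2 * f y - sum f (ends G e)))"
    using ends_in_verts by (intro sum.cong) auto
  also have "\<dots> = (\<Sum>e\<in>edges G. 2 * (\<Sum>y\<in>ends G e. g y * f y) - sum g (ends G e) * sum f (ends G e))"
    by (simp add: algebra_simps sum_subtractf sum_distrib_left sum_distrib_right)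
  finally show ?thesis .
qed

lemma laplace_symmetric:
  "(\<Sum>y\<in>verts G. g y * laplace f y) = (\<Sum>y\<in>verts G. f y * laplace g y)"
  unfolding sum_mult_laplace by (simp add: mult.commute)

text \<open>Off \<open>S\<close> the Laplacian of the Green function is a multiple of the point mass
  at \<open>v\<close>; what remains are boundary terms on \<open>S\<close>.\<close>

lemma sum_mult_laplace_green:
  assumes "S \<subseteq> verts G" "v \<in> verts G" "v \<notin> S"
  shows "(\<Sum>y\<in>verts G. g y * laplace (green S v) y) =
    g v * real (card (rooted_forests S)) + (\<Sum>s\<in>S. g s * laplace (green S v) s)"
proof -
  have "(\<Sum>y\<in>verts G. g y * laplace (green S v) y) =
      (\<Sum>y\<in>verts G - S. g y * laplace (green S v) y) + (\<Sum>s\<in>S. g s * laplace (green S v) s)"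
    by (rule sum.subset_diff[OF assms(1) finite_verts])
  also have "(\<Sum>y\<in>verts G - S. g y * laplace (green S v) y) =
      (\<Sum>y\<in>verts G - S. if y = v then g v * real (card (rooted_forests S)) else 0)"
    using laplace_green[OF assms(2,3)] by (intro sum.cong) auto
  also have "\<dots> = g v * real (card (rooted_forests S))"
    using assms finite_verts by simp
  finally show ?thesis .
qed

lemma rooted_forests_swap:
  assumes "(u, v) \<in> conn F" "F \<in> rooted_forests {u, q}" "u \<noteq> q"
  shows "F \<in> rooted_forests {v, q}"
proof -
  note D = rooted_forestsD[OF assms(2)]
  have "(x, v) \<in> conn F \<longleftrightarrow> (x, u) \<in> conn F" "(v, x) \<in> conn F \<longleftrightarrow> (u, x) \<in> conn F" for x
    using assms(1) by (simp_all add: conn_iff)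
  moreover have "(u, q) \<notin> conn F" using D(3)[of u q] assms(3) by auto
  ultimately show ?thesis
    using D(1,2) assms(1) unfolding rooted_forests_def by simp (metis conn_sym)
qed

text \<open>Both sides count the same forests: when \<open>u\<close> and \<open>v\<close> share a
  component, either may serve as its root.\<close>

lemma green_commute:
  assumes "u \<noteq> q" "v \<noteq> q"
  shows "green {q} u v = green {q} v u"
proof -
  have "{F \<in> rooted_forests {u, q}. (u, v) \<in> conn F} = {F \<in> rooted_forests {v, q}. (v, u) \<in> conn F}"
    using rooted_forests_swap[of u v _ q] rooted_forests_swap[of v u _ q] conn_sym[of u v] conn_sym[of v u]
      assms by blast
  then show ?thesis by (simp add: green_def)
qed

text \<open>This is the Jacobi identity for a \<open>2 \<times> 2\<close> minor of the Green function. It comes from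
  pairing the Green function grounded at \<open>{u, q}\<close> with those grounded at \<open>{q}\<close>.\<close>

lemma card_rooted_forests_minor:
  assumes V: "q \<in> verts G" "u \<in> verts G" "v \<in> verts G" and d: "u \<noteq> q" "v \<noteq> q" "u \<noteq> v"
    and pos: "rooted_forests {q} \<noteq> {}"
  shows "real (card (rooted_forests {q})) * real (card (rooted_forests {v, u, q})) =
    real (card (rooted_forests {u, q})) * real (card (rooted_forests {v, q})) - (green {q} u v)\<^sup>2"
proof -
  let ?k = "real (card (rooted_forests {q}))"
  let ?P = "green {q} u" and ?Q = "green {q} v" and ?H = "green {u, q} v"
  have q0: "?P q = 0" "?Q q = 0" "?H q = 0" "?H u = 0" using d by (auto intro: green_root)
  have k: "?k > 0" using pos finite_rooted_forests by (simp add: card_gt_0_iff)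
  \<comment> \<open>\<open>?P\<close> is largest at \<open>u\<close>, so \<open>?P u = 0\<close>
    would make it vanish, although its Laplacian at \<open>u\<close> is \<open>?k\<close>.\<close>
  have A: "?P u \<noteq> 0"
  proof
    assume "?P u = 0"
    then have "?P x = 0" for x using green_le[of "{q}" u x] by (simp add: green_def)
    then have "laplace ?P u = 0" by (simp add: laplace_def)
    then show False using laplace_green[of u "{q}" u] V d k by simp
  qed
  \<comment> \<open>\<open>?P\<close> vanishes at \<open>q\<close>, and \<open>?H\<close> at
    \<open>u\<close> and \<open>q\<close>. This pairing determines the boundary value
    \<open>laplace ?H u\<close>.\<close>
  have "?P v * ?P u + ?P u * laplace ?H u = (\<Sum>y\<in>verts G. ?P y * laplace ?H y)"
    using sum_mult_laplace_green[of "{u, q}" v ?P] V d q0 by (simp add: green_self)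
  also have "\<dots> = (\<Sum>y\<in>verts G. ?H y * laplace ?P y)" by (rule laplace_symmetric)
  also have "\<dots> = 0"
    using sum_mult_laplace_green[of "{q}" u ?H] V d q0 by simp
  finally have "?P u * (?P v + laplace ?H u) = 0" by (simp add: algebra_simps)
  then have LH: "laplace ?H u = - ?P v" using A by simp
  \<comment> \<open>With that value known, pairing \<open>?H\<close> with \<open>?Q\<close> yields
    \<open>?H v\<close>, the number of forests rooted at \<open>v\<close>, \<open>u\<close>,
    \<open>q\<close>.\<close>
  have "?Q v * ?P u + ?Q u * laplace ?H u = (\<Sum>y\<in>verts G. ?Q y * laplace ?H y)"
    using sum_mult_laplace_green[of "{u, q}" v ?Q] V d q0 by (simp add: green_self)
  also have "\<dots> = (\<Sum>y\<in>verts G. ?H y * laplace ?Q y)" by (rule laplace_symmetric)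
  also have "\<dots> = ?H v * ?k"
    using sum_mult_laplace_green[of "{q}" v ?H] V d q0 by simp
  finally have "?H v * ?k = ?Q v * ?P u - ?P v * ?P v"
    using LH green_commute[OF d(1,2)] by simp
  then show ?thesis by (simp add: green_self power2_eq_square mult.commute)
qed


section \<open>Spanning trees and two-forests as rooted forests\<close>

lemma conn_rel_edges_update:
  "conn_rel (G\<lparr>edges := F\<rparr>) = {(u, v). u \<in> verts G \<and> v \<in> verts G \<and> (u, v) \<in> conn F}"
  by (simp add: conn_rel_def adj_rel_def conn_def)

lemma spanning_forest_iff: "spanning_forest G F \<longleftrightarrow> forest F"
  using forest_iff_acyclic[of F] forestD(2)[of F] by (auto simp: spanning_forest_def)

text \<open>As the left-hand side does not mention \<open>q\<close>, a single root may be exchanged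
  for any other vertex.\<close>

lemma spanning_trees_eq:
  assumes q: "q \<in> verts G"
  shows "{F. spanning_tree G F} = rooted_forests {q}"
proof -
  have "(\<forall>u\<in>verts G. \<forall>v\<in>verts G. (u, v) \<in> conn F) \<longleftrightarrow> (\<forall>x\<in>verts G. (x, q) \<in> conn F)" for F
    using q by (metis conn_sym conn_trans)
  then show ?thesis
    using q by (auto simp: spanning_tree_def connected_mgraph_def conn_rel_edges_update
        spanning_forest_iff rooted_forests_def)
qed

text \<open>A pigeonhole form of having two components that speaks of vertices only and so suits
  first-order reasoning.\<close>

lemma two_forest_iff:
  "two_forest G F \<longleftrightarrow> forest F \<and> (\<exists>x\<in>verts G. \<exists>y\<in>verts G. (x, y) \<notin> conn F) \<and>
     (\<forall>x\<in>verts G. \<forall>y\<in>verts G. \<forall>z\<in>verts G. (x, y) \<in> conn F \<or> (y, z) \<in> conn F \<or> (x, z) \<in> conn F)"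
proof -
  define c where "c x = {y \<in> verts G. (x, y) \<in> conn F}" for x
  have comps: "conn_components (G\<lparr>edges := F\<rparr>) = c ` verts G"
    by (auto simp: conn_components_def conn_rel_edges_update quotient_def c_def)
  have c: "(x, y) \<in> conn F \<longleftrightarrow> c x = c y" if "x \<in> verts G" "y \<in> verts G" for x y
  proof
    assume "(x, y) \<in> conn F"
    then have "(x, z) \<in> conn F \<longleftrightarrow> (y, z) \<in> conn F" for z by (simp add: conn_iff)
    then show "c x = c y" by (simp add: c_def)
  next
    assume "c x = c y"
    moreover have "y \<in> c y" using that by (simp add: c_def)
    ultimately have "y \<in> c x" by simp
    then show "(x, y) \<in> conn F" by (simp add: c_def)
  qed
  have "card (c ` verts G) = 2 \<longleftrightarrow> (\<exists>x\<in>verts G. \<exists>y\<in>verts G. c x \<noteq> c y) \<and>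
     (\<forall>x\<in>verts G. \<forall>y\<in>verts G. \<forall>z\<in>verts G. c x = c y \<or> c y = c z \<or> c x = c z)" (is "?L \<longleftrightarrow> ?R")
  proof
    assume ?L
    then obtain a b where ab: "c ` verts G = {a, b}" "a \<noteq> b" by (auto simp: card_2_iff)
    then have "c x = a \<or> c x = b" if "x \<in> verts G" for x using that by blast
    moreover obtain x y where "x \<in> verts G" "y \<in> verts G" "c x = a" "c y = b"
      using ab by (metis imageE insertI1 insert_commute)
    ultimately show ?R using ab(2) by metis
  next
    assume R: ?R
    then obtain x y where xy: "x \<in> verts G" "y \<in> verts G" "c x \<noteq> c y" by blast
    then have "c z = c x \<or> c z = c y" if "z \<in> verts G" for z using R that by metis
    then have "c ` verts G = {c x, c y}" using xy by blast
    then show ?L using xy by simp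
  qed
  then show ?thesis
    unfolding two_forest_def spanning_forest_iff comps by (simp add: c)
qed

lemma finite_two_forests: "finite {F. two_forest G F}"
proof (rule finite_subset)
  show "{F. two_forest G F} \<subseteq> Pow (edges G)"
    using forestD(2) by (auto simp: two_forest_iff)
qed (use finite_edges in simp)

text \<open>If \<open>x\<close> and \<open>z\<close> are separated, their components are the only
  two, so each component contains exactly one of them.\<close>

lemma two_forests_separating:
  assumes "x \<in> verts G" "z \<in> verts G" "x \<noteq> z"
  shows "{F \<in> {F. two_forest G F}. (x, z) \<notin> conn F} = rooted_forests {x, z}"
proof (intro set_eqI iffI)
  fix F assume "F \<in> {F \<in> {F. two_forest G F}. (x, z) \<notin> conn F}"
  then have F: "two_forest G F" "(x, z) \<notin> conn F" by auto
  then have "(y, x) \<in> conn F \<or> (y, z) \<in> conn F" if "y \<in> verts G" for y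
    using that assms unfolding two_forest_iff by (metis conn_sym)
  then show "F \<in> rooted_forests {x, z}"
    using F conn_sym[of z x F] unfolding rooted_forests_def two_forest_iff by auto
next
  fix F assume F: "F \<in> rooted_forests {x, z}"
  note D = rooted_forestsD[OF F]
  have xz: "(x, z) \<notin> conn F" using D(3)[of x z] assms by auto
  have "(y, x) \<in> conn F \<or> (y, z) \<in> conn F" if "y \<in> verts G" for y
    using D(2)[OF that] by auto
  then have "\<forall>a\<in>verts G. \<forall>b\<in>verts G. \<forall>c\<in>verts G.
      (a, b) \<in> conn F \<or> (b, c) \<in> conn F \<or> (a, c) \<in> conn F"
    unfolding conn_iff by metis
  then show "F \<in> {F \<in> {F. two_forest G F}. (x, z) \<notin> conn F}"
    using xz D(1) assms unfolding two_forest_iff by blast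
qed

text \<open>Take a smallest edge set joining every vertex to \<open>q\<close>; an edge that is no
  bridge could be deleted from it.\<close>

lemma ex_spanning_tree:
  assumes "connected_mgraph G" "q \<in> verts G"
  shows "rooted_forests {q} \<noteq> {}"
proof -
  define P where "P F \<longleftrightarrow> F \<subseteq> edges G \<and> (\<forall>x\<in>verts G. (x, q) \<in> conn F)" for F
  have "G\<lparr>edges := edges G\<rparr> = G" by simp
  then have "P (edges G)"
    using assms conn_rel_edges_update[of "edges G"] by (auto simp: P_def connected_mgraph_def)
  then obtain T where T: "P T" and min: "\<And>F. P F \<Longrightarrow> card T \<le> card F"
    using ex_has_least_nat[of P "edges G" card] by blast
  have TE: "T \<subseteq> edges G" using T by (simp add: P_def)
  have finT: "finite T" using TE finite_edges finite_subset by blast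
  have "forest T"
    unfolding forest_def
  proof (intro conjI TE ballI allI impI notI)
    fix e u v assume e: "e \<in> T" "ends G e = {u, v}" and c: "(u, v) \<in> conn (T - {e})"
    have "(x, q) \<in> conn (T - {e})" if "x \<in> verts G" for x
    proof -
      have "(x, q) \<in> conn T" using T that by (simp add: P_def)
      from conn_removeD[OF this e] c show ?thesis by (auto simp: conn_iff)
    qed
    then have "P (T - {e})" using TE by (auto simp: P_def)
    from min[OF this] show False using card_Diff1_less[OF finT e(1)] by simp
  qed
  then have "T \<in> rooted_forests {q}" using T by (auto simp: rooted_forests_def P_def)
  then show ?thesis by blast
qed

text \<open>Deleting \<open>e\<close> from a spanning tree rooted at \<open>u\<close> makes
  \<open>v\<close> a second root: the exchange with \<open>S = {u}\<close>.\<close>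

lemma card_spanning_trees_containing:
  assumes V: "q \<in> verts G" and e: "e \<in> edges G" "ends G e = {u, v}"
  shows "card {T \<in> rooted_forests {q}. e \<in> T} =
    card {F \<in> {F. two_forest G F}. (u, v) \<notin> conn F}"
proof -
  have uv: "u \<in> verts G" "v \<in> verts G" "u \<noteq> v"
    using e ends_in_verts[OF e(1)] card_ends[OF e(1)] by auto
  have "rooted_forests {q} = rooted_forests {u}"
    using spanning_trees_eq[OF V] spanning_trees_eq[OF uv(1)] by simp
  moreover have "{T \<in> rooted_forests {u}. e \<in> T \<and> (v, v) \<in> conn (T - {e}) \<and>
      (\<exists>s\<in>{u}. (s, u) \<in> conn (T - {e}))} = {T \<in> rooted_forests {u}. e \<in> T}" by simp
  moreover have "{F \<in> rooted_forests {v, u}. (v, v) \<in> conn F \<and> (v, u) \<notin> conn F} =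
      rooted_forests {v, u}" using rooted_forestsD(3)[of _ "{v, u}" v u] uv by auto
  moreover have "{F \<in> {F. two_forest G F}. (u, v) \<notin> conn F} = rooted_forests {v, u}"
    using two_forests_separating[OF uv] by (simp add: insert_commute)
  ultimately show ?thesis
    using card_rooted_forests_insert[of v "{u}" e v u] e uv by (simp add: insert_commute)
qed

text \<open>Every spanning tree has \<open>card (verts G) - 1\<close> edges. Divided by the number
  of spanning trees, this is Foster's theorem on effective resistances.\<close>

lemma sum_card_spanning_trees_containing:
  assumes "q \<in> verts G"
  shows "(\<Sum>e\<in>edges G. card {T \<in> rooted_forests {q}. e \<in> T}) =
    (card (verts G) - 1) * card (rooted_forests {q})"
proof -
  have "(\<Sum>e\<in>edges G. card {T \<in> rooted_forests {q}. e \<in> T}) =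
      (\<Sum>T\<in>rooted_forests {q}. card {e \<in> edges G. e \<in> T})"
    by (rule sum_card_swap[OF finite_edges finite_rooted_forests])
  also have "\<dots> = (\<Sum>T\<in>rooted_forests {q}. card (verts G) - 1)"
  proof (rule sum.cong[OF refl])
    fix T assume T: "T \<in> rooted_forests {q}"
    note D = rooted_forestsD[OF T]
    have "{x \<in> verts G. (x, q) \<in> conn T} = verts G" using D(2) by auto
    moreover have "{e\<in>T. ends G e \<subseteq> verts G} = {e \<in> edges G. e \<in> T}"
      using forestD(2)[OF D(1)] ends_in_verts by blast
    ultimately show "card {e \<in> edges G. e \<in> T} = card (verts G) - 1"
      using forest_card_component_edges[OF D(1) assms] by simp
  qed
  finally show ?thesis by simp
qed

lemma two_forest_component_count:
  assumes F: "two_forest G F" and q: "q \<in> verts G"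
  shows "card {x \<in> verts G. (x, q) \<notin> conn F} =
    card {e\<in>edges G. e \<in> F \<and> (\<forall>u\<in>ends G e. (u, q) \<notin> conn F)} + 1"
proof -
  have fF: "forest F" using F by (simp add: two_forest_iff)
  obtain v where v: "v \<in> verts G" "(v, q) \<notin> conn F"
    using F q unfolding two_forest_iff conn_iff by metis
  have "(x, v) \<in> conn F \<longleftrightarrow> (x, q) \<notin> conn F" if "x \<in> verts G" for x
    using F q v that unfolding two_forest_iff conn_iff by metis
  then have C: "{x \<in> verts G. (x, v) \<in> conn F} = {x \<in> verts G. (x, q) \<notin> conn F}" by blast
  have "{e\<in>F. ends G e \<subseteq> {x \<in> verts G. (x, q) \<notin> conn F}} =
      {e\<in>edges G. e \<in> F \<and> (\<forall>u\<in>ends G e. (u, q) \<notin> conn F)}"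
    using forestD(2)[OF fF] ends_in_verts by blast
  then show ?thesis
    using forest_card_component_edges[OF fF v(1)] unfolding C by simp
qed

end

section \<open>Two-forests counted by what they separate from a fixed root\<close>

locale rooted_mgraph = fin_loopless_mgraph G for G :: "('v, 'e) mgraph" +
  fixes q :: 'v
  assumes root: "q \<in> verts G" and conn_G: "connected_mgraph G"
begin

text \<open>Divided by \<open>kappa G\<close>, \<open>sep {x}\<close> is the effective resistance
  \<open>h x\<close> and \<open>sep (ends G e)\<close> is the quantity \<open>b e\<close>.\<close>

definition sep :: "'v set \<Rightarrow> nat" where
  "sep X = card {F \<in> {F. two_forest G F}. \<forall>x\<in>X. (x, q) \<notin> conn F}"

lemma kappa_eq: "kappa G = card (rooted_forests {q})"
  by (simp add: kappa_def spanning_trees_eq[OF root])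

lemma kappa_pos: "kappa G > 0"
  using ex_spanning_tree[OF conn_G root] finite_rooted_forests by (simp add: kappa_eq card_gt_0_iff)

lemma sep_root: "q \<in> X \<Longrightarrow> sep X = 0"
proof -
  assume "q \<in> X"
  then have "{F \<in> {F. two_forest G F}. \<forall>x\<in>X. (x, q) \<notin> conn F} = {}" by blast
  then show ?thesis unfolding sep_def by (metis card.empty)
qed

lemma sep_singleton: "x \<in> verts G \<Longrightarrow> x \<noteq> q \<Longrightarrow> sep {x} = card (rooted_forests {x, q})"
  using two_forests_separating[OF _ root, of x] by (simp add: sep_def)

text \<open>Once \<open>x\<close> is separated from \<open>q\<close>, there are only two components,
  so \<open>y\<close> is joined to \<open>x\<close> exactly when it is separated from
  \<open>q\<close> too.\<close>

lemma green_eq_sep: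
  assumes "x \<in> verts G" "y \<in> verts G" "x \<noteq> q"
  shows "green {q} x y = real (sep {x, y})"
proof -
  have "(x, y) \<in> conn F \<longleftrightarrow> (y, q) \<notin> conn F" if "two_forest G F" "(x, q) \<notin> conn F" for F
    using that assms root unfolding two_forest_iff conn_iff by metis
  then have "{F \<in> {F \<in> {F. two_forest G F}. (x, q) \<notin> conn F}. (x, y) \<in> conn F} =
      {F \<in> {F. two_forest G F}. \<forall>z\<in>{x, y}. (z, q) \<notin> conn F}" by auto
  then show ?thesis
    unfolding two_forests_separating[OF assms(1) root assms(3)] by (simp add: green_def sep_def)
qed

text \<open>The surplus vertex in \<open>two_forest_component_count\<close>, summed over all
  two-forests, gives \<open>kappa2 G\<close>.\<close>

lemma kappa2_sum:
  "kappa2 G + (\<Sum>e\<in>edges G. card {F \<in> {F. two_forest G F}. e \<in> F \<and> (\<forall>u\<in>ends G e. (u, q) \<notin> conn F)}) =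
    (\<Sum>x\<in>verts G. sep {x})"
proof -
  let ?F = "{F. two_forest G F}"
  have "(\<Sum>x\<in>verts G. sep {x}) = (\<Sum>F\<in>?F. card {x \<in> verts G. (x, q) \<notin> conn F})"
    using sum_card_swap[OF finite_verts finite_two_forests, of "\<lambda>x F. (x, q) \<notin> conn F"]
    by (simp add: sep_def)
  also have "\<dots> = (\<Sum>F\<in>?F. card {e\<in>edges G. e \<in> F \<and> (\<forall>u\<in>ends G e. (u, q) \<notin> conn F)} + 1)"
    using two_forest_component_count[OF _ root] by (intro sum.cong) auto
  also have "\<dots> = (\<Sum>F\<in>?F. card {e\<in>edges G. e \<in> F \<and> (\<forall>u\<in>ends G e. (u, q) \<notin> conn F)}) + kappa2 G"
    unfolding kappa2_def sum.distrib by simp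
  finally show ?thesis
    using sum_card_swap[OF finite_edges finite_two_forests,
        of "\<lambda>e F. e \<in> F \<and> (\<forall>u\<in>ends G e. (u, q) \<notin> conn F)"] by simp
qed

text \<open>Deleting \<open>e\<close> and making \<open>v\<close> a root turns these two-forests
  into the forests rooted at \<open>v\<close>, \<open>u\<close>, \<open>q\<close>, which the minor
  counts.\<close>

lemma card_two_forests_containing:
  assumes e: "e \<in> edges G" "ends G e = {u, v}"
  shows "real (kappa G) * real (card {F \<in> {F. two_forest G F}. e \<in> F \<and> (\<forall>u\<in>ends G e. (u, q) \<notin> conn F)}) =
    real (sep {u}) * real (sep {v}) - (real (sep {u, v}))\<^sup>2"
proof -
  let ?N = "{F \<in> {F. two_forest G F}. e \<in> F \<and> (\<forall>u\<in>ends G e. (u, q) \<notin> conn F)}"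
  have uv: "u \<in> verts G" "v \<in> verts G" "u \<noteq> v"
    using e ends_in_verts[OF e(1)] card_ends[OF e(1)] by auto
  show ?thesis
  proof (cases "u = q \<or> v = q")
    case True
    \<comment> \<open>If an end of \<open>e\<close> is the root, both sides vanish.\<close>
    then have "?N = {}" using e by auto
    then have "card ?N = 0" by (metis card.empty)
    moreover have "sep {u, v} = 0" "sep {u} = 0 \<or> sep {v} = 0"
      using True sep_root[of "{u, v}"] sep_root[of "{u}"] sep_root[of "{v}"] by auto
    ultimately show ?thesis by auto
  next
    case False
    then have d: "u \<noteq> q" "v \<noteq> q" by auto
    have "(u, q) \<in> conn F \<longleftrightarrow> (v, q) \<in> conn F" if "e \<in> F" for F
      using conn_edge[OF that e(2)] by (simp add: conn_iff)
    then have "?N = {F \<in> {F \<in> {F. two_forest G F}. (u, q) \<notin> conn F}. e \<in> F}" using e(2) by auto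
    \<comment> \<open>The added conditions always hold, with \<open>s = u\<close>; they give the set
      the shape of the exchange.\<close>
    also have "\<dots> = {F \<in> rooted_forests {u, q}. e \<in> F \<and> (v, v) \<in> conn (F - {e}) \<and>
        (\<exists>s\<in>{u, q}. (s, u) \<in> conn (F - {e}))}"
      unfolding two_forests_separating[OF uv(1) root d(1)] by auto
    also have "card \<dots> = card {F \<in> rooted_forests {v, u, q}. (v, v) \<in> conn F \<and> (v, u) \<notin> conn F}"
      using card_rooted_forests_insert[of v "{u, q}" e v u] e uv d by (simp add: insert_commute)
    also have "{F \<in> rooted_forests {v, u, q}. (v, v) \<in> conn F \<and> (v, u) \<notin> conn F} =
        rooted_forests {v, u, q}" using rooted_forestsD(3)[of _ "{v, u, q}" v u] uv by auto
    finally have "card ?N = card (rooted_forests {v, u, q})" .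
    then show ?thesis
      using card_rooted_forests_minor[OF root uv(1,2) d uv(3) ex_spanning_tree[OF conn_G root]]
        green_eq_sep[OF uv(1,2) d(1)] sep_singleton[OF uv(1) d(1)] sep_singleton[OF uv(2) d(2)]
      by (simp add: kappa_eq)
  qed
qed

text \<open>The Laplace equation of the Green function with source \<open>v\<close>, read at
  \<open>v\<close> itself.\<close>

lemma sum_sep_edges:
  assumes "v \<in> verts G" "v \<noteq> q"
  shows "(\<Sum>e | e \<in> edges G \<and> v \<in> ends G e. real (sep {v}) - real (sep (ends G e))) = real (kappa G)"
proof -
  have "real (kappa G) = laplace (green {q} v) v"
    using laplace_green[of v "{q}" v] assms by (simp add: kappa_eq)
  also have "\<dots> = (\<Sum>e | e \<in> edges G \<and> v \<in> ends G e. real (sep {v}) - real (sep (ends G e)))"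
    unfolding laplace_def
  proof (rule sum.cong[OF refl])
    fix e assume "e \<in> {e. e \<in> edges G \<and> v \<in> ends G e}"
    then obtain w where w: "ends G e = {v, w}" "v \<noteq> w" "w \<in> verts G" using ends_other[of e v] by blast
    show "2 * green {q} v v - sum (green {q} v) (ends G e) = real (sep {v}) - real (sep (ends G e))"
      using w green_eq_sep[OF assms(1) _ assms(2)] assms(1) by simp
  qed
  finally show ?thesis by simp
qed

text \<open>The first term counts the two-forests separating \<open>u\<close> from \<open>v\<close>.
  A two-forest cuts off from \<open>q\<close> neither end, one end (the ends are then separated) or
  both (they are then joined), adding \<open>0\<close>, \<open>1\<close> or \<open>2\<close> to each
  side.\<close>

lemma sep_spanning_trees:
  assumes e: "e \<in> edges G" "ends G e = {u, v}"
  shows "card {T \<in> rooted_forests {q}. e \<in> T} + 2 * sep {u, v} = sep {u} + sep {v}"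
proof -
  let ?F = "{F. two_forest G F}"
  have uv: "u \<in> verts G" "v \<in> verts G"
    using e ends_in_verts[OF e(1)] by auto
  have card_sum: "card {F \<in> ?F. P F} = (\<Sum>F\<in>?F. if P F then 1 else 0)" for P
    using finite_two_forests by (simp add: sum.If_cases Collect_conj_eq)
  have "(if (u, v) \<notin> conn F then 1 else 0) + 2 * (if \<forall>x\<in>{u, v}. (x, q) \<notin> conn F then 1 else 0) =
      (if \<forall>x\<in>{u}. (x, q) \<notin> conn F then 1 else 0) + (if \<forall>x\<in>{v}. (x, q) \<notin> conn F then 1 else (0 :: nat))"
    if "F \<in> ?F" for F
  proof -
    have "(u, v) \<in> conn F \<or> (v, q) \<in> conn F \<or> (u, q) \<in> conn F"
      using that uv root unfolding two_forest_iff by blast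
    then show ?thesis by (auto simp: conn_iff)
  qed
  then have "(\<Sum>F\<in>?F. (if (u, v) \<notin> conn F then 1 else 0) +
        2 * (if \<forall>x\<in>{u, v}. (x, q) \<notin> conn F then 1 else 0)) =
      (\<Sum>F\<in>?F. (if \<forall>x\<in>{u}. (x, q) \<notin> conn F then 1 else 0) +
        (if \<forall>x\<in>{v}. (x, q) \<notin> conn F then 1 else (0 :: nat)))"
    by (rule sum.cong[OF refl])
  then show ?thesis
    unfolding card_spanning_trees_containing[OF root e] sep_def card_sum
    by (simp only: sum.distrib sum_distrib_left)
qed

section \<open>The ratio as a sum over edges, and the bound\<close>

text \<open>The factor after \<open>3\<close> is \<open>(h u - h v)\<^sup>2\<close> for
  \<open>e = uv\<close>, written with sums so that the ends need no names.\<close>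

lemma two_forest_spanning_tree_ratio:
  "real (kappa2 G) / real (kappa G) =
    (\<Sum>e\<in>edges G. ((real (card {T \<in> rooted_forests {q}. e \<in> T}) / real (kappa G))\<^sup>2 +
      3 * (2 * (\<Sum>x\<in>ends G e. (real (sep {x}) / real (kappa G))\<^sup>2) -
        (\<Sum>x\<in>ends G e. real (sep {x}) / real (kappa G))\<^sup>2)) / 4)"
proof -
  let ?k = "real (kappa G)"
  define h where "h x = real (sep {x}) / ?k" for x
  define b where "b e = real (sep (ends G e)) / ?k" for e
  define r where "r e = real (card {T \<in> rooted_forests {q}. e \<in> T}) / ?k" for e
  define N where "N e = real (card {F \<in> {F. two_forest G F}. e \<in> F \<and> (\<forall>u\<in>ends G e. (u, q) \<notin> conn F)})" for e
  have k: "?k > 0" using kappa_pos by simp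
  \<comment> \<open>The Laplace equation times \<open>h v\<close>; at the root both sides are
    \<open>0\<close> because \<open>h q = 0\<close>.\<close>
  have flow: "(\<Sum>e | e \<in> edges G \<and> v \<in> ends G e. h v * (h v - b e)) = h v" if "v \<in> verts G" for v
  proof (cases "v = q")
    case True
    then show ?thesis by (simp add: h_def sep_root)
  next
    case False
    have "h v - b e = (real (sep {v}) - real (sep (ends G e))) / ?k" for e
      by (simp add: h_def b_def diff_divide_distrib)
    then have "(\<Sum>e | e \<in> edges G \<and> v \<in> ends G e. h v - b e) = 1"
      using sum_sep_edges[OF that False] k by (simp add: sum_divide_distrib[symmetric])
    then show ?thesis by (simp add: sum_distrib_left[symmetric])
  qed
  have "(\<Sum>v\<in>verts G. h v) = (\<Sum>v\<in>verts G. \<Sum>e | e \<in> edges G \<and> v \<in> ends G e. h v * (h v - b e))"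
    using flow by simp
  also have "\<dots> = (\<Sum>e\<in>edges G. \<Sum>v | v \<in> verts G \<and> v \<in> ends G e. h v * (h v - b e))"
    by (rule sum.swap_restrict[OF finite_verts finite_edges])
  also have "\<dots> = (\<Sum>e\<in>edges G. \<Sum>v\<in>ends G e. h v * (h v - b e))"
    using ends_in_verts by (intro sum.cong) auto
  finally have 1: "(\<Sum>v\<in>verts G. h v) = (\<Sum>e\<in>edges G. \<Sum>v\<in>ends G e. h v * (h v - b e))" .
  have "real (kappa2 G) + (\<Sum>e\<in>edges G. N e) = (\<Sum>v\<in>verts G. real (sep {v}))"
    using arg_cong[OF kappa2_sum, of real] by (simp add: N_def)
  then have "real (kappa2 G) / ?k = (\<Sum>v\<in>verts G. h v) - (\<Sum>e\<in>edges G. N e / ?k)"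
    by (simp add: h_def sum_divide_distrib[symmetric] diff_divide_distrib[symmetric])
  also have "\<dots> = (\<Sum>e\<in>edges G. (\<Sum>v\<in>ends G e. h v * (h v - b e)) - N e / ?k)"
    unfolding 1 by (simp add: sum_subtractf)
  also have "\<dots> = (\<Sum>e\<in>edges G. ((r e)\<^sup>2 + 3 * (2 * (\<Sum>x\<in>ends G e. (h x)\<^sup>2) - (\<Sum>x\<in>ends G e. h x)\<^sup>2)) / 4)"
  proof (rule sum.cong[OF refl])
    fix e assume e: "e \<in> edges G"
    obtain u v where uv: "ends G e = {u, v}" "u \<noteq> v" using ends_cases[OF e] by metis
    have "N e = (real (sep {u}) * real (sep {v}) - (real (sep {u, v}))\<^sup>2) / ?k"
      using card_two_forests_containing[OF e uv(1)] k unfolding N_def by (simp add: field_simps)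
    then have N: "N e / ?k = h u * h v - (b e)\<^sup>2"
      using k by (simp add: h_def b_def uv power2_eq_square field_simps)
    have "real (card {T \<in> rooted_forests {q}. e \<in> T}) =
        real (sep {u}) + real (sep {v}) - 2 * real (sep {u, v})"
      using arg_cong[OF sep_spanning_trees[OF e uv(1)], of real] by simp
    then have r: "r e = h u + h v - 2 * b e"
      by (simp add: r_def h_def b_def uv diff_divide_distrib add_divide_distrib)
    show "(\<Sum>v\<in>ends G e. h v * (h v - b e)) - N e / ?k =
        ((r e)\<^sup>2 + 3 * (2 * (\<Sum>x\<in>ends G e. (h x)\<^sup>2) - (\<Sum>x\<in>ends G e. h x)\<^sup>2)) / 4"
      unfolding N r using uv by (simp add: power2_eq_square field_simps)
  qed
  finally show ?thesis unfolding h_def r_def .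
qed

lemma two_forest_spanning_tree_bound:
  "(real (card (verts G)) - 1)\<^sup>2 / (4 * real (card (edges G))) \<le> real (kappa2 G) / real (kappa G)"
proof -
  let ?k = "real (kappa G)" and ?m = "real (card (edges G))"
  define r where "r e = real (card {T \<in> rooted_forests {q}. e \<in> T}) / ?k" for e
  have k: "?k > 0" using kappa_pos by simp
  \<comment> \<open>Makes the truncated subtraction of \<open>1\<close> exact.\<close>
  have "card (verts G) \<ge> 1" using root finite_verts by (simp add: Suc_le_eq card_gt_0_iff) blast
  then have "(\<Sum>e\<in>edges G. r e) = real (card (verts G)) - 1"
    using arg_cong[OF sum_card_spanning_trees_containing[OF root], of real] k
    by (simp add: r_def sum_divide_distrib[symmetric] kappa_eq of_nat_diff)
  then have "(real (card (verts G)) - 1)\<^sup>2 = (\<Sum>e\<in>edges G. 1 * r e)\<^sup>2" by simp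
  also have "\<dots> \<le> (\<Sum>e\<in>edges G. 1\<^sup>2) * (\<Sum>e\<in>edges G. (r e)\<^sup>2)"
    by (rule Cauchy_Schwarz_ineq_sum)
  finally have CS: "(real (card (verts G)) - 1)\<^sup>2 \<le> ?m * (\<Sum>e\<in>edges G. (r e)\<^sup>2)" by simp
  have "(\<Sum>e\<in>edges G. (r e)\<^sup>2 / 4) \<le> real (kappa2 G) / ?k"
    unfolding two_forest_spanning_tree_ratio r_def[symmetric]
  proof (rule sum_mono)
    fix e assume "e \<in> edges G"
    then obtain u v where uv: "ends G e = {u, v}" "u \<noteq> v" using ends_cases by metis
    \<comment> \<open>The squared differences of \<open>h\<close> along the edges are nonnegative
      and are dropped.\<close>
    have "(x + y)\<^sup>2 \<le> 2 * x\<^sup>2 + 2 * y\<^sup>2" for x y :: real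
      using zero_le_power2[of "x - y"] by (simp add: power2_eq_square algebra_simps)
    from this[of "real (sep {u}) / ?k" "real (sep {v}) / ?k"] show "(r e)\<^sup>2 / 4 \<le> ((r e)\<^sup>2 + 3 * (2 * (\<Sum>x\<in>ends G e. (real (sep {x}) / ?k)\<^sup>2) -
        (\<Sum>x\<in>ends G e. real (sep {x}) / ?k)\<^sup>2)) / 4"
      using uv by simp
  qed
  then have "(\<Sum>e\<in>edges G. (r e)\<^sup>2) / 4 \<le> real (kappa2 G) / ?k"
    by (simp add: sum_divide_distrib)
  moreover have "(real (card (verts G)) - 1)\<^sup>2 / (4 * ?m) \<le> (\<Sum>e\<in>edges G. (r e)\<^sup>2) / 4"
  proof (cases "?m = 0")
    case True
    \<comment> \<open>Without edges the left-hand side is a division by zero, hence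
      \<open>0\<close>.\<close>
    then show ?thesis by (simp add: sum_nonneg)
  next
    case False
    then show ?thesis using CS by (simp add: field_simps)
  qed
  ultimately show ?thesis by linarith
qed

end

theorem theorem6p1:
  fixes G :: "('v, 'e) mgraph"
  assumes "fin_loopless_mgraph G"
    and "connected_mgraph G"
    and "card (verts G) \<ge> 2"
  shows "real (kappa2 G) / real (kappa G)
           \<ge> (real (card (verts G)) - 1)\<^sup>2 / (4 * real (card (edges G)))"
proof -
  obtain q where "q \<in> verts G" using assms(2) by (auto simp: connected_mgraph_def)
  then interpret rooted_mgraph G q
    using assms by (simp add: rooted_mgraph_def rooted_mgraph_axioms_def)
  show ?thesis by (rule two_forest_spanning_tree_bound)
qed

end
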